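(* Let $s \geq 0$. There exists a constant $c_s > 0$ (depending only on $s$) such that for every integer $n \geq 2$ and every set of $n$ lines $\ell_1, \dots, \ell_n$ in $\mathbb{R}^2$ such that any two of the lines intersect in some point, the $1/n$-neighborhoods $T_1, \dots, T_n$ of these lines satisfy $$ \sum_{\substack{i,j=1 \\ i \neq j}}^{n} |T_i \cap T_j|^s \;\geq\; c_s \begin{cases} n^{2-2s} & \text{if } 0 \leq s < 1, \\ \log n & \text{if } s = 1, \\ n^{1-s} & \text{if } s > 1. \end{cases}$$
   Context: The lines are (infinite) affine lines in the Euclidean plane; they form a set of $n$ distinct lines, so the hypothesis says that no two are parallel. The $1/n$-neighborhood of a line is the set of points of $\mathbb{R}^2$ at Euclidean distance at most $1/n$ from it. $|\cdot|$ denotes two-dimensional Lebesgue measure. The sum runs over ordered pairs $(i,j)$ with $i\neq j$. *)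

theory Defs
  imports "HOL-Analysis.Analysis"
begin

definition is_line :: "(real^2) set \<Rightarrow> bool" where
  "is_line L \<longleftrightarrow> affine L \<and> aff_dim L = 1"

(* infdist is 0 by convention for the empty set; a line is never empty. *)
definition nbhd :: "real \<Rightarrow> (real^2) set \<Rightarrow> (real^2) set" where
  "nbhd \<delta> L = {x. infdist x L \<le> \<delta>}"

definition lower_rate :: "real \<Rightarrow> nat \<Rightarrow> real" where
  "lower_rate s n =
     (if s < 1 then real n powr (2 - 2 * s)
      else if s = 1 then ln (real n)
      else real n powr (1 - s))"

end

theory Submission
  imports Defs
begin

text \<open>Lines whose normals make an angle \<open>\<theta>\<close> have neighborhoods that meet in a parallelogram of
  area \<open>4 / (n\<^sup>2 sin \<theta>)\<close>.  Split the angles of the normals, taken in \<open>[0, \<pi>)\<close>, into \<open>m \<le> n/2\<close>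
  buckets of equal length.  By Cauchy--Schwarz at least \<open>n\<^sup>2/m - n \<ge> n\<^sup>2/(2m)\<close> ordered pairs of
  distinct lines share a bucket, and each such pair has area at least \<open>4m / (\<pi> n\<^sup>2)\<close>.
  For \<open>s > 1\<close> the finest such scale \<open>m = \<lfloor>n/2\<rfloor>\<close> suffices, for \<open>s = 1\<close> one adds up all the
  scales \<open>m \<le> n/2\<close> (a layer-cake argument), and for \<open>s < 1\<close> the trivial bound \<open>sin \<theta> \<le> 1\<close> is enough.\<close>

section \<open>Normal form of lines and the area in which two strips meet\<close>

definition strip :: "real \<Rightarrow> real \<Rightarrow> real \<Rightarrow> (real^2) set" where
  "strip t c \<delta> = {x. \<bar>cos t * x $ 1 + sin t * x $ 2 - c\<bar> \<le> \<delta>}"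

text \<open>Antipodal unit vectors are normals of the same line, so the sign \<open>e\<close> moves
  the point to the closed upper half circle. The endpoint \<open>pi\<close> is then traded for 0
  with the opposite sign: a half-open range makes the angle of a line unique.\<close>

lemma unit_circle_upper_half:
  fixes x y :: real
  assumes "x\<^sup>2 + y\<^sup>2 = 1"
  obtains e t where "e = 1 \<or> e = -1" "0 \<le> t" "t < pi" "x = e * cos t" "y = e * sin t"
proof -
  have "\<exists>e t. (e = 1 \<or> e = -1) \<and> 0 \<le> t \<and> t \<le> pi \<and> x = e * cos t \<and> y = e * sin t"
  proof (cases "y \<ge> 0")
    case True
    then show ?thesis using sincos_total_pi[OF _ assms] by (metis mult_1)
  next
    case False
    then have "0 \<le> - y" and "(- x)\<^sup>2 + (- y)\<^sup>2 = 1" using assms by auto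
    from sincos_total_pi[OF this] obtain t where "0 \<le> t" "t \<le> pi" "- x = cos t" "- y = sin t"
      by blast
    then show ?thesis by (intro exI[of _ "-1"] exI[of _ t]) auto
  qed
  then obtain e t where *: "e = 1 \<or> e = -1" "0 \<le> t" "t \<le> pi" "x = e * cos t" "y = e * sin t"
    by blast
  show thesis
  proof (cases "t = pi")
    case True
    then show thesis using * by (intro that[of "- e" 0]) auto
  next
    case False
    then show thesis using * by (intro that[of e t]) auto
  qed
qed

text \<open>A line in the plane is a hyperplane; dividing its equation by the length
  \<open>r\<close> of the normal and by the sign \<open>e\<close> leaves a unit normal with angle in
  the half-open range.\<close>

lemma is_line_normal_form:
  assumes "is_line L"
  obtains t c where "0 \<le> t" "t < pi" "L = {x. cos t * x $ 1 + sin t * x $ 2 = c}"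
proof -
  have "affine L" and dim: "aff_dim L = int (DIM(real^2) - 1)"
    using assms by (auto simp: is_line_def)
  then have "affine hull L = L" by (simp add: hull_same)
  with iffD1[OF aff_dim_eq_hyperplane dim] obtain a b where a: "a \<noteq> 0" and L: "L = {x. a \<bullet> x = b}"
    by auto
  have ip: "a \<bullet> x = a $ 1 * x $ 1 + a $ 2 * x $ 2" for x
    by (simp add: inner_vec_def sum_2)
  define r where "r = norm a"
  have r: "r > 0" using a by (simp add: r_def)
  have "r\<^sup>2 = (a $ 1)\<^sup>2 + (a $ 2)\<^sup>2"
    unfolding r_def power2_norm_eq_inner ip by (simp add: power2_eq_square)
  then have "(a $ 1 / r)\<^sup>2 + (a $ 2 / r)\<^sup>2 = 1"
    using r by (auto simp: power_divide simp flip: add_divide_distrib)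
  then obtain e t where e: "e = 1 \<or> e = -1" and t: "0 \<le> t" "t < pi"
    and xy: "a $ 1 / r = e * cos t" "a $ 2 / r = e * sin t"
    by (rule unit_circle_upper_half)
  have a12: "a $ 1 = r * e * cos t" "a $ 2 = r * e * sin t"
    using xy r by (auto simp: field_simps)
  have "a \<bullet> x = (r * e) * (cos t * x $ 1 + sin t * x $ 2)" for x
    unfolding ip a12 by (simp add: algebra_simps)
  moreover have "r * e \<noteq> 0" using r e by auto
  ultimately have "a \<bullet> x = b \<longleftrightarrow> cos t * x $ 1 + sin t * x $ 2 = b / (r * e)" for x
    by (simp add: field_simps)
  then show thesis using t L that by auto
qed

text \<open>The coefficient vector \<open>v\<close> has norm 1, so the residual of the equation at
  \<open>x\<close> is the distance of \<open>x\<close> from the line: the foot of the perpendicular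
  gives one inequality, Cauchy-Schwarz the other.\<close>

lemma nbhd_line_eq_strip: "nbhd \<delta> {x. cos t * x $ 1 + sin t * x $ 2 = c} = strip t c \<delta>"
proof -
  define v :: "real^2" where "v = vector [cos t, sin t]"
  have v: "cos t * x $ 1 + sin t * x $ 2 = v \<bullet> x" for x
    by (simp add: v_def inner_vec_def sum_2)
  have v1: "v \<bullet> v = 1"
    using sin_cos_squared_add[of t] by (simp add: v_def inner_vec_def sum_2 power2_eq_square)
  then have nv: "norm v = 1" by (simp add: norm_eq_1)
  let ?L = "{x. v \<bullet> x = c}"
  have "infdist x ?L = \<bar>v \<bullet> x - c\<bar>" for x
  proof (rule antisym)
    have p: "x - (v \<bullet> x - c) *\<^sub>R v \<in> ?L" by (simp add: inner_diff_right v1)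
    then have "infdist x ?L \<le> dist x (x - (v \<bullet> x - c) *\<^sub>R v)" by (rule infdist_le)
    then show "infdist x ?L \<le> \<bar>v \<bullet> x - c\<bar>" by (simp add: dist_norm nv)
    have "\<bar>v \<bullet> x - c\<bar> \<le> dist x y" if "y \<in> ?L" for y
      using that Cauchy_Schwarz_ineq2[of v "x - y"] by (simp add: inner_diff_right nv dist_norm)
    with p show "\<bar>v \<bullet> x - c\<bar> \<le> infdist x ?L"
      unfolding infdist_def by (auto intro!: cINF_greatest)
  qed
  then show ?thesis by (simp add: nbhd_def strip_def v)
qed

text \<open>The matrix \<open>A\<close> with the two unit normals as rows maps the parallelogram
  onto a square of side \<open>2 * \<delta>\<close>, and its determinant is
  \<open>sin (u - t)\<close>.\<close>

lemma measure_strip_Int: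
  assumes "\<delta> \<ge> 0" and "sin (u - t) \<noteq> 0"
  shows "measure lebesgue (strip t c \<delta> \<inter> strip u d \<delta>) * \<bar>sin (u - t)\<bar> = 4 * \<delta>\<^sup>2"
proof -
  define A :: "real^2^2" where "A = vector [vector [cos t, sin t], vector [cos u, sin u]]"
  have A: "(A *v x) $ 1 = cos t * x $ 1 + sin t * x $ 2"
    "(A *v x) $ 2 = cos u * x $ 1 + sin u * x $ 2" for x
    by (auto simp: A_def matrix_vector_mult_def sum_2)
  have detA: "det A = sin (u - t)"
    by (simp add: A_def det_2 sin_diff algebra_simps)
  define p :: "real^2" where "p = vector [c - \<delta>, d - \<delta>]"
  define q :: "real^2" where "q = vector [c + \<delta>, d + \<delta>]"
  have S: "strip t c \<delta> \<inter> strip u d \<delta> = {x. A *v x \<in> cbox p q}"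
    by (auto simp: strip_def mem_box_cart A forall_2 p_def q_def)
  have "invertible A" using detA assms by (simp add: invertible_det_nz)
  then obtain B where B: "A ** B = mat 1" "B ** A = mat 1"
    by (auto simp: invertible_def)
  have AB: "A *v (B *v x) = x" "B *v (A *v x) = x" for x
    by (simp_all add: matrix_vector_mul_assoc B)
  \<comment> \<open>As the image of a box under the inverse of \<open>A\<close>, the parallelogram
    is measurable with finite measure, so the determinant formula applies to it.\<close>
  have SB: "strip t c \<delta> \<inter> strip u d \<delta> = (*v) B ` cbox p q"
    unfolding S by (force simp: AB image_iff)
  then have "strip t c \<delta> \<inter> strip u d \<delta> \<in> lmeasurable"
    by (simp add: measurable_linear_image)
  then have "measure lebesgue ((*v) A ` (strip t c \<delta> \<inter> strip u d \<delta>)) =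
      \<bar>det A\<bar> * measure lebesgue (strip t c \<delta> \<inter> strip u d \<delta>)"
    using measure_linear_image[of "(*v) A"] by simp
  moreover have "(*v) A ` (strip t c \<delta> \<inter> strip u d \<delta>) = cbox p q"
    unfolding SB by (simp add: image_image AB)
  moreover have "measure lebesgue (cbox p q) = 4 * \<delta>\<^sup>2"
  proof -
    have "cbox p q \<noteq> {}" using assms by (simp add: interval_ne_empty_cart forall_2 p_def q_def)
    then show ?thesis
      by (simp add: content_cbox_cart UNIV_2 p_def q_def power2_eq_square)
  qed
  ultimately show ?thesis using detA by (simp add: mult.commute)
qed

text \<open>Angles in the half-open range differ by less than \<open>pi\<close>, so a vanishing sine
  forces equal angles; parallel lines with a common point coincide.\<close>

lemma sin_angle_diff_nonzero:
  assumes "{x. cos t * x $ 1 + sin t * x $ 2 = c} \<noteq> {x::real^2. cos u * x $ 1 + sin u * x $ 2 = d}"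
    and "{x. cos t * x $ 1 + sin t * x $ 2 = c} \<inter> {x::real^2. cos u * x $ 1 + sin u * x $ 2 = d} \<noteq> {}"
    and "0 \<le> t" "t < pi" "0 \<le> u" "u < pi"
  shows "sin (u - t) \<noteq> 0"
proof
  assume "sin (u - t) = 0"
  then have "u = t" using assms(3-) sin_eq_0_pi[of "u - t"] by auto
  with assms(1,2) show False by auto
qed

section \<open>Counting pairs of angles in a common bucket\<close>

lemma card_pairs_same_fiber:
  fixes f :: "'a \<Rightarrow> nat"
  assumes "finite A" and "m > 0" and "\<And>i. i \<in> A \<Longrightarrow> f i < m"
  shows "(real (card A))\<^sup>2 / m - card A \<le> card {(i, j). i \<in> A \<and> j \<in> A \<and> i \<noteq> j \<and> f i = f j}"
proof -
  define F where "F b = {i \<in> A. f i = b}" for b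
  have finF: "finite (F b)" for b using assms by (simp add: F_def)
  let ?P = "{(i, j). i \<in> A \<and> j \<in> A \<and> i \<noteq> j \<and> f i = f j}"
  have finP: "finite ?P" by (rule finite_subset[of _ "A \<times> A"]) (use assms in auto)
  have A_eq: "A = (\<Union>b<m. F b)" using assms by (auto simp: F_def)
  have cA: "card A = (\<Sum>b<m. card (F b))"
    by (subst A_eq, rule card_UN_disjoint) (auto simp: F_def assms)
  \<comment> \<open>The squared fiber sizes count ordered pairs including the diagonal, which is the
    \<open>card A\<close> subtracted in the bound.\<close>
  have "(\<Union>b<m. F b \<times> F b) = ?P \<union> (\<lambda>i. (i, i)) ` A"
    using assms by (auto simp: F_def)
  moreover have "card (\<Union>b<m. F b \<times> F b) = (\<Sum>b<m. card (F b \<times> F b))"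
    by (rule card_UN_disjoint) (auto simp: F_def assms)
  moreover have "card (?P \<union> (\<lambda>i. (i, i)) ` A) = card ?P + card A"
    using finP assms by (subst card_Un_disjoint) (auto simp: card_image inj_on_def)
  ultimately have P: "real (card ?P) + card A = (\<Sum>b<m. (real (card (F b)))\<^sup>2)"
    by (simp add: card_cartesian_product power2_eq_square flip: of_nat_add of_nat_mult)
  have "(\<Sum>b<m. real (card (F b)))\<^sup>2 \<le> (\<Sum>b<m. (real (card (F b)))\<^sup>2) * card {..<m}"
    by (rule sum_squared_le_sum_of_squares)
  then have "(real (card A))\<^sup>2 \<le> (real (card ?P) + card A) * m"
    unfolding P by (simp add: cA)
  then show ?thesis using \<open>m > 0\<close> by (simp add: field_simps)
qed

definition bucket :: "nat \<Rightarrow> real \<Rightarrow> nat" where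
  "bucket m t = nat \<lfloor>m * t / pi\<rfloor>"

lemma bucket_less:
  assumes "0 \<le> t" "t < pi" "m > 0"
  shows "bucket m t < m"
proof -
  have "m * t / pi < m" using assms by (simp add: field_simps)
  then show ?thesis using assms by (simp add: bucket_def nat_less_iff floor_less_iff)
qed

text \<open>Equal floors put the scaled angles within 1 of each other, and |sin x| <= |x|. Since the
  angles are nonnegative, \<open>nat\<close> does not merge distinct floors.\<close>

lemma bucket_eq_imp_sin_le:
  assumes "0 \<le> t" "0 \<le> u" "m > 0" "bucket m t = bucket m u"
  shows "m * \<bar>sin (u - t)\<bar> \<le> pi"
proof -
  have "\<lfloor>m * t / pi\<rfloor> = \<lfloor>m * u / pi\<rfloor>"
    using assms by (auto simp: bucket_def eq_nat_nat_iff)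
  then have "\<bar>m * u / pi - m * t / pi\<bar> \<le> 1" by linarith
  then have "\<bar>m * (u - t) / pi\<bar> \<le> 1" by (simp add: right_diff_distrib diff_divide_distrib)
  then have "m * \<bar>u - t\<bar> \<le> pi" by (simp add: abs_mult)
  then show ?thesis
    using mult_left_mono[OF abs_sin_x_le_abs_x[of "u - t"], of "real m"] by linarith
qed

text \<open>Since \<open>2 * m\<close> is at most \<open>n\<close>, the diagonal contribution
  \<open>n\<close> is at most half of n^2 / m.\<close>

lemma card_pairs_same_bucket:
  assumes "n \<ge> 2" and "m > 0" and "2 * m \<le> n"
    and "\<And>i. i \<in> {1..n} \<Longrightarrow> 0 \<le> \<theta> i \<and> \<theta> i < pi"
  shows "(real n)\<^sup>2 / (2 * m) \<le>
    card {(i, j). i \<in> {1..n} \<and> j \<in> {1..n} \<and> i \<noteq> j \<and> bucket m (\<theta> i) = bucket m (\<theta> j)}"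
proof -
  have "real n * (2 * m) \<le> (real n)\<^sup>2" using assms(3)
    by (auto simp: power2_eq_square intro!: mult_left_mono simp flip: of_nat_mult)
  then have "(real n)\<^sup>2 / (2 * m) \<le> (real n)\<^sup>2 / m - n" using assms(2) by (simp add: field_simps)
  also have "\<dots> \<le> card {(i, j). i \<in> {1..n} \<and> j \<in> {1..n} \<and> i \<noteq> j \<and> bucket m (\<theta> i) = bucket m (\<theta> j)}"
    using card_pairs_same_fiber[of "{1..n}" m "\<lambda>i. bucket m (\<theta> i)"] assms
    by (simp add: bucket_less)
  finally show ?thesis .
qed

section \<open>Lower bounds for the power sums, with the geometry reduced to angles and
  areas\<close>

locale bucketed_areas =
  fixes n :: nat and \<theta> :: "nat \<Rightarrow> real" and a :: "nat \<Rightarrow> nat \<Rightarrow> real" and P :: "(nat \<times> nat) set"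
  defines "P \<equiv> {(i, j). i \<in> {1..n} \<and> j \<in> {1..n} \<and> i \<noteq> j}"
  assumes n: "n \<ge> 2"
    and \<theta>: "\<And>i. i \<in> {1..n} \<Longrightarrow> 0 \<le> \<theta> i \<and> \<theta> i < pi"
    and area: "\<And>i j. (i, j) \<in> P \<Longrightarrow> a i j * \<bar>sin (\<theta> j - \<theta> i)\<bar> = 4 / (real n)\<^sup>2"
    and area_nonneg: "\<And>i j. (i, j) \<in> P \<Longrightarrow> a i j \<ge> 0"
begin

lemma finite_P: "finite P"
  by (rule finite_subset[of _ "{1..n} \<times> {1..n}"]) (auto simp: P_def)

lemma card_P: "card P = n * (n - 1)"
proof -
  have "P = (SIGMA i:{1..n}. {1..n} - {i})" by (auto simp: P_def)
  then show ?thesis by simp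
qed

lemma area_ge:
  assumes "(i, j) \<in> P"
  shows "a i j \<ge> 4 / (real n)\<^sup>2"
  using area[OF assms] mult_left_mono[OF abs_sin_le_one[of "\<theta> j - \<theta> i"] area_nonneg[OF assms]]
  by simp

lemma area_ge_of_same_bucket:
  assumes "(i, j) \<in> P" "m > 0" "bucket m (\<theta> i) = bucket m (\<theta> j)"
  shows "a i j \<ge> 4 / (pi * (real n)\<^sup>2) * m"
proof -
  have "m * \<bar>sin (\<theta> j - \<theta> i)\<bar> \<le> pi"
    using assms \<theta> by (intro bucket_eq_imp_sin_le) (auto simp: P_def)
  from mult_left_mono[OF this area_nonneg[OF assms(1)]]
  have "m * (4 / (real n)\<^sup>2) \<le> a i j * pi"
    unfolding area[OF assms(1), symmetric] by (simp add: mult_ac)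
  then have "m * (4 / (real n)\<^sup>2) / pi \<le> a i j"
    by (subst pos_divide_le_eq) (auto simp: mult_ac)
  then show ?thesis by (simp add: mult_ac)
qed

lemma same_bucket_count:
  assumes "m > 0" "2 * m \<le> n"
  shows "(real n)\<^sup>2 / (2 * m) \<le> card {(i, j) \<in> P. bucket m (\<theta> i) = bucket m (\<theta> j)}"
proof -
  have "{(i, j) \<in> P. bucket m (\<theta> i) = bucket m (\<theta> j)} =
      {(i, j). i \<in> {1..n} \<and> j \<in> {1..n} \<and> i \<noteq> j \<and> bucket m (\<theta> i) = bucket m (\<theta> j)}"
    by (auto simp: P_def)
  then show ?thesis using card_pairs_same_bucket[OF n assms, of \<theta>] \<theta> by simp
qed

text \<open>The factor 1/2 comes from n (n - 1) >= n^2 / 2; weakening the area bound from 4 / n^2 to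
  1 / n^2 keeps the constant free of \<open>s\<close>. The areas are positive, so the convention
  \<open>0 powr 0 = 0\<close> does no harm at \<open>s = 0\<close>.\<close>

lemma sum_ge_subcritical:
  assumes "s \<ge> 0"
  shows "(\<Sum>(i, j)\<in>P. a i j powr s) \<ge> 1 / 2 * real n powr (2 - 2 * s)"
proof -
  have "1 / 2 * real n powr (2 - 2 * s) = (real n)\<^sup>2 / 2 * (1 / (real n)\<^sup>2) powr s"
  proof -
    have "(1 / (real n)\<^sup>2) powr s = real n powr (- 2 * s)"
      using n by (simp add: powr_divide powr_powr powr_minus_divide flip: powr_numeral)
    then show ?thesis
      using n by (simp add: powr_diff powr_minus_divide)
  qed
  also have "\<dots> \<le> card P * (4 / (real n)\<^sup>2) powr s"
  proof (intro mult_mono powr_mono2)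
    have "(real n)\<^sup>2 = real n * n" by (simp add: power2_eq_square)
    also have "\<dots> \<le> real n * (2 * (n - 1))"
      using n by (intro mult_left_mono) auto
    finally show "(real n)\<^sup>2 / 2 \<le> card P" using n by (simp add: card_P of_nat_diff algebra_simps)
  qed (use assms n in \<open>auto simp: divide_right_mono\<close>)
  also have "\<dots> = (\<Sum>(i, j)\<in>P. (4 / (real n)\<^sup>2) powr s)" by (simp add: case_prod_unfold)
  also have "\<dots> \<le> (\<Sum>(i, j)\<in>P. a i j powr s)"
    by (intro sum_mono) (auto intro!: powr_mono2 area_ge assms)
  finally show ?thesis .
qed

lemma sum_ge_critical: "(\<Sum>(i, j)\<in>P. a i j) \<ge> 1 / pi * ln n"
proof -
  define M where "M = n div 2"
  define K where "K = 4 / (pi * (real n)\<^sup>2)"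
  have K: "K \<ge> 0" by (simp add: K_def)
  \<comment> \<open>Layer cake: the area dominates \<open>K\<close> times the number of scales at
    which the two angles share a bucket.\<close>
  have area_layers: "K * (\<Sum>m\<in>{1..M}. of_bool (bucket m (\<theta> i) = bucket m (\<theta> j))) \<le> a i j"
    if ij: "(i, j) \<in> P" for i j
  proof -
    define S where "S = {m \<in> {1..M}. bucket m (\<theta> i) = bucket m (\<theta> j)}"
    have S: "(\<Sum>m\<in>{1..M}. of_bool (bucket m (\<theta> i) = bucket m (\<theta> j))) = real (card S)"
      by (simp add: S_def of_bool_def sum.If_cases Int_def)
    show ?thesis
    proof (cases "S = {}")
      case True
      then show ?thesis unfolding S using area_nonneg[OF ij] by simp
    next
      case False
      have fin: "finite S" by (simp add: S_def)
      have mS: "Max S \<in> S" using fin False by simp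
      \<comment> \<open>Buckets at different scales are not nested, so \<open>S\<close> may have
        gaps; its size is still at most its largest scale, which bounds the area.\<close>
      have "S \<subseteq> {1..Max S}" using fin by (auto simp: S_def)
      from card_mono[OF _ this] have "card S \<le> Max S" by simp
      then have "K * card S \<le> K * Max S" using K by (intro mult_left_mono) auto
      also have "\<dots> \<le> a i j"
        using mS unfolding K_def by (intro area_ge_of_same_bucket ij) (auto simp: S_def)
      finally show ?thesis unfolding S .
    qed
  qed
  have "real n \<le> (real M + 1)\<^sup>2"
  proof -
    have "real n \<le> 2 * M + 1" unfolding M_def by linarith
    also have "\<dots> \<le> (real M + 1)\<^sup>2" by (simp add: power2_sum)
    finally show ?thesis .
  qed
  then have "ln n \<le> ln ((real M + 1)\<^sup>2)" using n by (subst ln_le_cancel_iff) auto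
  also have "\<dots> = 2 * ln (real M + 1)" by (simp add: ln_realpow)
  also have "\<dots> \<le> 2 * harm M" using ln_le_harm[of M] by (simp add: add.commute)
  finally have "1 / pi * ln n \<le> 1 / pi * (2 * harm M)" by (intro mult_left_mono) auto
  \<comment> \<open>Each scale \<open>m\<close> contributes K n^2 / (2 m) = 2 / (pi m), which
    produces the harmonic sum.\<close>
  also have "\<dots> = K * (\<Sum>m\<in>{1..M}. (real n)\<^sup>2 / (2 * m))"
    using n by (simp add: harm_def sum_distrib_left K_def field_simps)
  also have "\<dots> \<le> K * (\<Sum>m\<in>{1..M}. card {(i, j) \<in> P. bucket m (\<theta> i) = bucket m (\<theta> j)})"
    unfolding of_nat_sum by (intro mult_left_mono sum_mono same_bucket_count K) (auto simp: M_def)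
  \<comment> \<open>Counts become sums of indicators, so that scales and pairs can be
    interchanged.\<close>
  also have "\<dots> = K * (\<Sum>m\<in>{1..M}. \<Sum>(i, j)\<in>P. of_bool (bucket m (\<theta> i) = bucket m (\<theta> j)))"
    using finite_P
    by (simp add: case_prod_unfold of_bool_def sum.If_cases Int_def)
  also have "\<dots> = (\<Sum>(i, j)\<in>P. K * (\<Sum>m\<in>{1..M}. of_bool (bucket m (\<theta> i) = bucket m (\<theta> j))))"
    unfolding case_prod_unfold by (subst sum.swap) (simp add: sum_distrib_left)
  also have "\<dots> \<le> (\<Sum>(i, j)\<in>P. a i j)"
    using area_layers by (intro sum_mono) auto
  finally show ?thesis .
qed

text \<open>At the finest scale \<open>M\<close> at least \<open>n\<close> pairs share a bucket, and
  each of them has area at least 1 / (pi n).\<close>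

lemma sum_ge_supercritical:
  assumes "s \<ge> 0"
  shows "(\<Sum>(i, j)\<in>P. a i j powr s) \<ge> (1 / pi) powr s * real n powr (1 - s)"
proof -
  define M where "M = n div 2"
  \<comment> \<open>\<open>2 * M <= n\<close> bounds the number of pairs from below;
    \<open>n <= 4 * M\<close> turns the area bound 4 M / (pi n^2) into 1 / (pi n).\<close>
  have M: "M > 0" "2 * M \<le> n" "n \<le> 4 * M" using n by (auto simp: M_def)
  define Q where "Q = {(i, j) \<in> P. bucket M (\<theta> i) = bucket M (\<theta> j)}"
  have "real n = (real n)\<^sup>2 / n" using n by (simp add: power2_eq_square)
  also have "\<dots> \<le> (real n)\<^sup>2 / (2 * M)"
    using M by (intro divide_left_mono) auto
  also have "\<dots> \<le> card Q" unfolding Q_def by (rule same_bucket_count) (use M in auto)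
  finally have cQ: "real n \<le> card Q" .
  have "(1 / pi) powr s * real n powr (1 - s) = n * (1 / (pi * n)) powr s"
    using n by (simp add: powr_divide powr_mult powr_diff)
  also have "\<dots> \<le> card Q * (1 / (pi * n)) powr s"
    using cQ by (intro mult_right_mono) auto
  also have "\<dots> = (\<Sum>(i, j)\<in>Q. (1 / (pi * n)) powr s)" by (simp add: case_prod_unfold)
  also have "\<dots> \<le> (\<Sum>(i, j)\<in>Q. a i j powr s)"
  proof -
    have "1 / (pi * n) \<le> a i j" if "(i, j) \<in> Q" for i j
    proof -
      have "1 / (pi * n) = 1 / (pi * (real n)\<^sup>2) * n" using n by (simp add: power2_eq_square)
      also have "\<dots> \<le> 1 / (pi * (real n)\<^sup>2) * (4 * M)"
        using M(3) by (intro mult_left_mono) auto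
      also have "\<dots> \<le> a i j"
        using that area_ge_of_same_bucket[of i j M] M by (auto simp: Q_def)
      finally show ?thesis .
    qed
    then show ?thesis using assms by (intro sum_mono) (auto intro!: powr_mono2)
  qed
  also have "\<dots> \<le> (\<Sum>(i, j)\<in>P. a i j powr s)"
    using finite_P by (intro sum_mono2) (auto simp: Q_def)
  finally show ?thesis .
qed

text \<open>At \<open>s = 1\<close> the second constant equals \<open>1 / pi\<close>, the one from
  the layer-cake bound, so two branches cover three regimes.\<close>

lemma sum_ge_lower_rate:
  assumes "s \<ge> 0"
  shows "(\<Sum>(i, j)\<in>P. a i j powr s) \<ge>
    (if s < 1 then 1 / 2 else (1 / pi) powr s) * lower_rate s n"
proof (cases "s = 1")
  case True
  have "(\<Sum>(i, j)\<in>P. a i j powr s) = (\<Sum>(i, j)\<in>P. a i j)"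
    using True area_nonneg by (intro sum.cong) auto
  with True sum_ge_critical show ?thesis by (simp add: lower_rate_def)
next
  case False
  then show ?thesis
    using sum_ge_subcritical[OF assms] sum_ge_supercritical[OF assms]
    by (auto simp: lower_rate_def)
qed

end

section \<open>From lines to angles and areas\<close>

theorem mainTheorem3:
  fixes s :: real
  assumes "s \<ge> 0"
  shows "\<exists>c::real. c > 0 \<and>
    (\<forall>(n::nat) (L :: nat \<Rightarrow> (real^2) set).
       n \<ge> 2 \<longrightarrow>
       (\<forall>i\<in>{1..n}. is_line (L i)) \<longrightarrow>
       inj_on L {1..n} \<longrightarrow>
       (\<forall>i\<in>{1..n}. \<forall>j\<in>{1..n}. i \<noteq> j \<longrightarrow> L i \<inter> L j \<noteq> {}) \<longrightarrow>
       (\<Sum>(i, j)\<in>{(i, j). i \<in> {1..n} \<and> j \<in> {1..n} \<and> i \<noteq> j}.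
          measure lebesgue (nbhd (1 / real n) (L i) \<inter> nbhd (1 / real n) (L j)) powr s)
       \<ge> c * lower_rate s n)"
proof (intro exI conjI allI impI)
  show "(if s < 1 then 1 / 2 else (1 / pi) powr s) > 0" by simp
  fix n :: nat and L :: "nat \<Rightarrow> (real^2) set"
  assume n: "n \<ge> 2" and lines: "\<forall>i\<in>{1..n}. is_line (L i)" and inj: "inj_on L {1..n}"
    and meet: "\<forall>i\<in>{1..n}. \<forall>j\<in>{1..n}. i \<noteq> j \<longrightarrow> L i \<inter> L j \<noteq> {}"
  have "\<forall>i\<in>{1..n}. \<exists>t c. 0 \<le> t \<and> t < pi \<and> L i = {x. cos t * x $ 1 + sin t * x $ 2 = c}"
  proof
    fix i assume "i \<in> {1..n}"
    then have "is_line (L i)" using lines by blast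
    then show "\<exists>t c. 0 \<le> t \<and> t < pi \<and> L i = {x. cos t * x $ 1 + sin t * x $ 2 = c}"
      by (rule is_line_normal_form) blast
  qed
  from bchoice[OF this] obtain \<theta> where "\<forall>i\<in>{1..n}. \<exists>c. 0 \<le> \<theta> i \<and> \<theta> i < pi \<and>
      L i = {x. cos (\<theta> i) * x $ 1 + sin (\<theta> i) * x $ 2 = c}"
    by blast
  from bchoice[OF this] obtain c where \<theta>: "\<And>i. i \<in> {1..n} \<Longrightarrow> 0 \<le> \<theta> i \<and> \<theta> i < pi"
    and L: "\<And>i. i \<in> {1..n} \<Longrightarrow> L i = {x. cos (\<theta> i) * x $ 1 + sin (\<theta> i) * x $ 2 = c i}"
    by blast
  interpret bucketed_areas n \<theta>
    "\<lambda>i j. measure lebesgue (nbhd (1 / real n) (L i) \<inter> nbhd (1 / real n) (L j))"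
    "{(i, j). i \<in> {1..n} \<and> j \<in> {1..n} \<and> i \<noteq> j}"
  proof unfold_locales
    fix i j assume "(i, j) \<in> {(i, j). i \<in> {1..n} \<and> j \<in> {1..n} \<and> i \<noteq> j}"
    then have ij: "i \<in> {1..n}" "j \<in> {1..n}" "i \<noteq> j" by auto
    \<comment> \<open>Injectivity excludes coinciding lines and the intersection hypothesis excludes
      distinct parallel ones, so the area identity has a nonzero sine.\<close>
    have "L i \<noteq> L j" "L i \<inter> L j \<noteq> {}" using ij inj meet by (auto dest: inj_onD)
    then have "sin (\<theta> j - \<theta> i) \<noteq> 0"
      unfolding L[OF ij(1)] L[OF ij(2)] by (rule sin_angle_diff_nonzero) (use \<theta> ij in auto)
    from measure_strip_Int[OF _ this, of "1 / real n" "c i" "c j"]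
    show "measure lebesgue (nbhd (1 / real n) (L i) \<inter> nbhd (1 / real n) (L j)) *
        \<bar>sin (\<theta> j - \<theta> i)\<bar> = 4 / (real n)\<^sup>2"
      unfolding L[OF ij(1)] L[OF ij(2)] nbhd_line_eq_strip by (simp add: power_divide)
  qed (use n \<theta> in auto)
  show "(\<Sum>(i, j)\<in>{(i, j). i \<in> {1..n} \<and> j \<in> {1..n} \<and> i \<noteq> j}.
          measure lebesgue (nbhd (1 / real n) (L i) \<inter> nbhd (1 / real n) (L j)) powr s)
       \<ge> (if s < 1 then 1 / 2 else (1 / pi) powr s) * lower_rate s n"
    by (rule sum_ge_lower_rate[OF assms])
qed

end
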